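(* Let $f$ and $g$ be transcendental entire functions such that $CP(f\circ g)$ is bounded. Then $CV(g)$ is also bounded. Moreover, if $f$ permutes with $f'$ (i.e. $f\circ f'=f'\circ f$) and $0$ is a fixed point of $f$, then $f$ has at most one critical value, which (if it exists) is a Picard exceptional value of $g$.
   Context: For an entire function $h$: $CP(h)=\{z\in\mathbb{C}: h'(z)=0\}$ is the set of critical points of $h$, and $CV(h)=h(CP(h))$ is the set of critical values of $h$. $f'$ denotes the derivative of $f$. A Picard exceptional value of a transcendental entire function $h$ is a point $w\in\mathbb{C}$ such that $h(z)=w$ has at most finitely many solutions $z\in\mathbb{C}$. *)

theory Defs
  imports "HOL-Complex_Analysis.Complex_Analysis" "HOL-Computational_Algebra.Polynomial"
begin

definition transcendental_entire :: "(complex \<Rightarrow> complex) \<Rightarrow> bool" where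
  "transcendental_entire h \<longleftrightarrow> h holomorphic_on UNIV \<and> \<not> (\<exists>p :: complex poly. h = poly p)"

definition CP :: "(complex \<Rightarrow> complex) \<Rightarrow> complex set" where
  "CP h = {z. deriv h z = 0}"

definition CV :: "(complex \<Rightarrow> complex) \<Rightarrow> complex set" where
  "CV h = h ` CP h"

text \<open>The equation may have finitely many solutions; the value need not be omitted altogether.\<close>
definition picard_exceptional_value :: "(complex \<Rightarrow> complex) \<Rightarrow> complex \<Rightarrow> bool" where
  "picard_exceptional_value h w \<longleftrightarrow> transcendental_entire h \<and> finite {z. h z = w}"

end

(* Since (f o g)' = f'(g) g', the bounded set CP (f o g) contains CP g as well as the
   preimage under g of every critical point of f. Bounded preimages are finite, so by the great
   Picard theorem f has at most one critical point c. If f commutes with f' and f 0 = 0, then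
   f' (f c) = f (f' c) = f 0 = 0, so that f maps CP f into itself. *)
theory Submission
  imports Defs
begin

lemma transcendental_entire_not_constant:
  assumes "transcendental_entire h"
  shows "\<not> h constant_on UNIV"
proof
  assume "h constant_on UNIV"
  then obtain c where "h z = c" for z
    unfolding constant_on_def by auto
  then have "h = poly [:c:]"
    by (intro ext) simp
  with assms show False
    unfolding transcendental_entire_def by blast
qed

text \<open>By Liouville, an entire function with a finite limit at infinity is constant. This rules
  out a removable singularity at infinity.\<close>

lemma transcendental_entire_not_tendsto:
  assumes "transcendental_entire h"
  shows "\<not> (h \<longlongrightarrow> l) at_infinity"
proof
  assume "(h \<longlongrightarrow> l) at_infinity"
  with assms have "h z = l" for z
    unfolding transcendental_entire_def using Liouville_weak by blast
  with transcendental_entire_not_constant[OF assms] show False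
    unfolding constant_on_def by blast
qed

text \<open>A limit of \<open>1/h\<close> at infinity would leave \<open>h\<close> with at most a
  pole there (\<open>l = 0\<close> is the case of a pole), and such an entire function is a
  polynomial.\<close>

lemma transcendental_entire_not_inverse_tendsto:
  assumes "transcendental_entire h"
  shows "\<not> ((inverse \<circ> h) \<longlongrightarrow> l) at_infinity"
proof
  assume "((inverse \<circ> h) \<longlongrightarrow> l) at_infinity"
  moreover have "h holomorphic_on UNIV"
    using assms unfolding transcendental_entire_def by blast
  ultimately obtain a n where "\<And>z. h z = (\<Sum>i\<le>n. a i * z ^ i)"
    using pole_at_infinity by blast
  then have "h = poly (\<Sum>i\<le>n. monom (a i) i)"
    by (auto simp: poly_sum poly_monom)
  with assms show False
    unfolding transcendental_entire_def by blast
qed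

text \<open>Infinity is an essential singularity of \<open>h\<close>. The substitution of
  \<open>1/z\<close> for \<open>z\<close> moves it to 0, where the great Picard theorem allows only
  one value to be taken finitely often.\<close>

lemma picard_exceptional_value_unique:
  assumes "picard_exceptional_value h a" "picard_exceptional_value h b"
  shows "a = b"
proof -
  have h: "transcendental_entire h"
    using assms(1) unfolding picard_exceptional_value_def by blast
  have hol: "h \<circ> inverse holomorphic_on UNIV - {0}"
    using h unfolding transcendental_entire_def
    by (intro holomorphic_on_compose) (auto intro: holomorphic_intros holomorphic_on_subset)
  have lim: "\<not> ((h \<circ> inverse) \<longlongrightarrow> l) (at 0)" for l
    using transcendental_entire_not_tendsto[OF h, of l] by (simp add: lim_at_infinity_0)
  have inv_lim: "\<not> ((inverse \<circ> (h \<circ> inverse)) \<longlongrightarrow> l) (at 0)" for l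
    using transcendental_entire_not_inverse_tendsto[OF h, of l]
    by (simp add: lim_at_infinity_0[of "inverse \<circ> h"] comp_assoc)
  obtain e where
    e: "\<And>w. w \<noteq> e \<Longrightarrow> infinite {z. z \<in> UNIV - {0} \<and> (h \<circ> inverse) z = w}"
    by (rule great_Picard_infinite[OF open_UNIV UNIV_I hol lim inv_lim]) blast
  have "w = e" if "picard_exceptional_value h w" for w
  proof (rule ccontr)
    assume "w \<noteq> e"
    have "finite (inverse ` {z. h z = w})"
      using that unfolding picard_exceptional_value_def by blast
    \<comment> \<open>Inversion is an involution, so each \<open>z\<close> here is the inverse of
      the solution \<open>inverse z\<close>. The right-hand side may also contain 0, since
      \<open>inverse 0 = 0\<close>.\<close>
    moreover have "{z. z \<in> UNIV - {0} \<and> (h \<circ> inverse) z = w} \<subseteq> inverse ` {z. h z = w}"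
    proof
      fix z assume "z \<in> {z. z \<in> UNIV - {0} \<and> (h \<circ> inverse) z = w}"
      then have "h (inverse z) = w" by simp
      then show "z \<in> inverse ` {z. h z = w}"
        by (intro image_eqI[of _ _ "inverse z"]) auto
    qed
    ultimately show False
      using e[OF \<open>w \<noteq> e\<close>] finite_subset by blast
  qed
  with assms show ?thesis by blast
qed

text \<open>The fibre is closed by continuity, hence compact once bounded. The zeros of the
  nonconstant entire function \<open>h z - w\<close> are isolated, so a compact set contains only
  finitely many.\<close>

lemma finite_bounded_preimage:
  assumes "transcendental_entire h" "bounded {z. h z = w}"
  shows "finite {z. h z = w}"
proof -
  have hol: "h holomorphic_on UNIV"
    using assms(1) unfolding transcendental_entire_def by blast
  then have "closed {z. h z = w}"
    by (intro closed_Collect_eq holomorphic_on_imp_continuous_on) auto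
  with assms(2) have "compact {z. h z = w}"
    by (simp add: compact_eq_bounded_closed)
  moreover have "\<not> (\<lambda>z. h z - w) constant_on UNIV"
    using transcendental_entire_not_constant[OF assms(1)]
    unfolding constant_on_def by (metis diff_add_cancel)
  ultimately have "finite {z \<in> {z. h z = w}. h z - w = 0}"
    using hol by (intro holomorphic_compact_finite_zeros[of _ UNIV]) (auto intro: holomorphic_intros)
  then show ?thesis by simp
qed

lemma CP_compose:
  assumes "f holomorphic_on UNIV" "g holomorphic_on UNIV"
  shows "CP (f \<circ> g) = CP g \<union> g -` CP f"
proof -
  have "deriv (f \<circ> g) z = deriv f (g z) * deriv g z" for z
    using assms
    by (intro deriv_chain) (auto intro: holomorphic_on_imp_differentiable_at[of _ UNIV])
  then show ?thesis
    unfolding CP_def by auto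
qed

text \<open>As the zero set of the continuous function \<open>deriv h\<close>, \<open>CP h\<close>
  is closed. Boundedness makes it compact, and so is its image under \<open>h\<close>.\<close>

lemma bounded_CV:
  assumes "h holomorphic_on UNIV" "bounded (CP h)"
  shows "bounded (CV h)"
proof -
  have "continuous_on UNIV (deriv h)"
    using assms(1) by (intro holomorphic_on_imp_continuous_on holomorphic_deriv) auto
  then have "closed (CP h)"
    unfolding CP_def by (intro closed_Collect_eq) auto
  with assms(2) have "compact (CP h)"
    by (simp add: compact_eq_bounded_closed)
  moreover have "continuous_on (CP h) h"
    using assms(1) holomorphic_on_imp_continuous_on continuous_on_subset by blast
  ultimately show ?thesis
    unfolding CV_def by (intro compact_imp_bounded compact_continuous_image)
qed

theorem theorem2p8:
  fixes f g :: "complex \<Rightarrow> complex"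
  assumes "transcendental_entire f"
    and "transcendental_entire g"
    and "bounded (CP (f \<circ> g))"
  shows "bounded (CV g) \<and>
    (f \<circ> deriv f = deriv f \<circ> f \<and> f 0 = 0 \<longrightarrow>
      (\<forall>v\<in>CV f. \<forall>w\<in>CV f. v = w) \<and> (\<forall>v\<in>CV f. picard_exceptional_value g v))"
proof -
  have hol: "f holomorphic_on UNIV" "g holomorphic_on UNIV"
    using assms(1,2) unfolding transcendental_entire_def by blast+
  note CP_fg = CP_compose[OF hol]
  have "bounded (CP g)"
    using assms(3) unfolding CP_fg by simp
  then have "bounded (CV g)"
    using bounded_CV hol(2) by blast
  moreover have exceptional: "picard_exceptional_value g c" if "c \<in> CP f" for c
  proof -
    have "{z. g z = c} \<subseteq> CP (f \<circ> g)"
      using that unfolding CP_fg by auto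
    then have "finite {z. g z = c}"
      using assms(2,3) finite_bounded_preimage bounded_subset by blast
    with assms(2) show ?thesis
      unfolding picard_exceptional_value_def by blast
  qed
  moreover have "CV f \<subseteq> CP f" if "f \<circ> deriv f = deriv f \<circ> f" "f 0 = 0"
  proof -
    have "deriv f (f c) = f (deriv f c)" for c
      using fun_cong[OF that(1), of c] by simp
    with that(2) show ?thesis
      unfolding CV_def CP_def by auto
  qed
  \<comment> \<open>Every critical value of \<open>f\<close> is itself a critical point of
    \<open>f\<close>, so \<open>exceptional\<close> applies to it directly. Two critical values are
    then both exceptional for \<open>g\<close> and must coincide.\<close>
  ultimately show ?thesis
    using picard_exceptional_value_unique by blast
qed

end
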